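(* Let $Y\subseteq\mathbb{U}^*$ be a cycle property and let $\mathcal{A}$ be a $Y$-unambiguous arena with labels in $\mathbb{U}$. Then the game $(\mathcal{A},O_{\mathrm{FC}(Y)}(\mathcal{A}))$ is pointwise memoryless determined. If moreover $Y$ is closed under cyclic permutations, then this game is uniform memoryless determined.
   Context: An arena is a tuple $\mathcal{A}=(V_0,V_1,E,\mathbb{U},\lambda)$ where $V_0,V_1$ are disjoint finite sets (the vertices of Player 0 and Player 1) with $V:=V_0\cup V_1$ non-empty, $E\subseteq V\times V$ is a set of edges such that every vertex has at least one outgoing edge, $\mathbb{U}$ is a set of labels, and $\lambda:E\to\mathbb{U}$. For a sequence of edges $u=e_1e_2\cdots$, write $\lambda(u)=\lambda(e_1)\lambda(e_2)\cdots$. A play is an infinite sequence $\pi=\pi_0\pi_1\cdots$ of vertices with $(\pi_j,\pi_{j+1})\in E$ for all $j$; a suffix of $\pi$ is a play $\pi_j\pi_{j+1}\cdots$ for some $j\ge0$. A strategy for Player $i$ is a function $S:V^*V_i\to V$ with $(v,S(uv))\in E$ for all $u\in V^*$, $v\in V_i$; it is memoryless if $S(uv)=S(u'v)$ for all $u,u'\in V^*$, $v\in V_i$. A play is consistent with a strategy $S$ of Player $i$ if $\pi_{j+1}=S(\pi_0\cdots\pi_j)$ whenever $\pi_j\in V_i$. A game is a pair $(\mathcal{A},O)$ with $O$ a set of plays; a play is won by Player 0 if it is in $O$ and by Player 1 otherwise. A strategy for Player $i$ is winning from $v$ if every play starting at $v$ consistent with it is won by Player $i$. The winning region of Player $i$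 is the set of vertices from which Player $i$ has a winning strategy. The game is determined if the two winning regions partition $V$. It is pointwise memoryless for Player $i$ if from every vertex of Player $i$'s winning region Player $i$ has a memoryless winning strategy; it is uniform memoryless for Player $i$ if there is one memoryless strategy for Player $i$ winning from every vertex of Player $i$'s winning region. It is pointwise (resp. uniform) memoryless determined if it is determined and pointwise (resp. uniform) memoryless for both players. A cycle is a sequence of edges $(v_1,v_2)(v_2,v_3)\cdots(v_{k-1},v_k)(v_k,v_1)$. The cycles-decomposition $\mathrm{cycles}(\pi)$ of a play $\pi$ is the sequence of cycles output by the following procedure: start with an empty stack; at step $j=0,1,2,\dots$ push the edge $(\pi_j,\pi_{j+1})$, and if for some $k$ the top $k$ edges of the stack form a cycle, pop this cycle and output it. The first cycle of $\pi$ is the first cycle in $\mathrm{cycles}(\pi)$. A cycle property is a set $Y\subseteq\mathbb{U}^*$, and $\neg Y:=\mathbb{U}^*\setminus Y$. $Y$ is closed under cyclic permutations if $ab\in Y$ implies $ba\in Y$ for all $a\in\mathbb{U}$, $b\in\mathbb{U}^*$. $O_{\mathrm{FC}(Y)}(\mathcal{A})$ is the set of plays $\pi$ such that $\lambda(u)\in Y$, where $u$ is the first cycle of $\pi$. $O_{\mathrm{EAC}(Y)}(\mathcal{A})$ is the set of plays $\pi$ having some suffix $\pi'$ such that $\lambda(u)\in Y$ for every cycle $u$ in $\mathrm{cycles}(\pi')$. The arena $\mathcal{A}$ is $Y$-unambiguous if $O_{\mathrm{EAC}(Y)}(\mathcal{A})\cap O_{\mathrm{EAC}(\neg Y)}(\mathcal{A})=\emptyset$.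 *)

theory Defs
  imports Main "HOL-Library.Infinite_Set"
begin

record ('v, 'l) arena =
  verts0 :: "'v set"
  verts1 :: "'v set"
  edges :: "('v \<times> 'v) set"
  labels :: "'l set"
  lab :: "'v \<times> 'v \<Rightarrow> 'l"

definition verts :: "('v, 'l) arena \<Rightarrow> 'v set" where
  "verts A = verts0 A \<union> verts1 A"

definition is_arena :: "('v, 'l) arena \<Rightarrow> bool" where
  "is_arena A \<longleftrightarrow>
     finite (verts0 A) \<and> finite (verts1 A) \<and> verts0 A \<inter> verts1 A = {} \<and> verts A \<noteq> {} \<and>
     edges A \<subseteq> verts A \<times> verts A \<and>
     (\<forall>v \<in> verts A. \<exists>w. (v, w) \<in> edges A) \<and>
     lab A ` edges A \<subseteq> labels A"

datatype player = P0 | P1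

fun owned :: "('v, 'l) arena \<Rightarrow> player \<Rightarrow> 'v set" where
  "owned A P0 = verts0 A"
| "owned A P1 = verts1 A"

definition plays :: "('v, 'l) arena \<Rightarrow> (nat \<Rightarrow> 'v) set" where
  "plays A = {\<pi>. \<forall>j. (\<pi> j, \<pi> (Suc j)) \<in> edges A}"

definition suffix_at :: "(nat \<Rightarrow> 'v) \<Rightarrow> nat \<Rightarrow> nat \<Rightarrow> 'v" where
  "suffix_at \<pi> j = (\<lambda>n. \<pi> (j + n))"

text \<open>A strategy is only constrained on histories ending in a vertex of the player; its values
  on all other lists are irrelevant.\<close>

definition strategy :: "('v, 'l) arena \<Rightarrow> player \<Rightarrow> ('v list \<Rightarrow> 'v) \<Rightarrow> bool" where
  "strategy A i S \<longleftrightarrow>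
     (\<forall>u \<in> lists (verts A). \<forall>v \<in> owned A i. (v, S (u @ [v])) \<in> edges A)"

definition memoryless :: "('v, 'l) arena \<Rightarrow> player \<Rightarrow> ('v list \<Rightarrow> 'v) \<Rightarrow> bool" where
  "memoryless A i S \<longleftrightarrow>
     (\<forall>u \<in> lists (verts A). \<forall>u' \<in> lists (verts A). \<forall>v \<in> owned A i. S (u @ [v]) = S (u' @ [v]))"

definition consistent ::
  "('v, 'l) arena \<Rightarrow> player \<Rightarrow> ('v list \<Rightarrow> 'v) \<Rightarrow> (nat \<Rightarrow> 'v) \<Rightarrow> bool" where
  "consistent A i S \<pi> \<longleftrightarrow>
     (\<forall>j. \<pi> j \<in> owned A i \<longrightarrow> \<pi> (Suc j) = S (map \<pi> [0..<Suc j]))"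

text \<open>A game is given by an arena \<open>A\<close> and a set \<open>W\<close> of plays, the objective of Player 0.\<close>

fun won_by :: "(nat \<Rightarrow> 'v) set \<Rightarrow> player \<Rightarrow> (nat \<Rightarrow> 'v) \<Rightarrow> bool" where
  "won_by W P0 \<pi> \<longleftrightarrow> \<pi> \<in> W"
| "won_by W P1 \<pi> \<longleftrightarrow> \<pi> \<notin> W"

definition winning_from ::
  "('v, 'l) arena \<Rightarrow> (nat \<Rightarrow> 'v) set \<Rightarrow> player \<Rightarrow> ('v list \<Rightarrow> 'v) \<Rightarrow> 'v \<Rightarrow> bool" where
  "winning_from A W i S v \<longleftrightarrow>
     (\<forall>\<pi> \<in> plays A. \<pi> 0 = v \<and> consistent A i S \<pi> \<longrightarrow> won_by W i \<pi>)"

definition winning_region :: "('v, 'l) arena \<Rightarrow> (nat \<Rightarrow> 'v) set \<Rightarrow> player \<Rightarrow> 'v set" where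
  "winning_region A W i = {v \<in> verts A. \<exists>S. strategy A i S \<and> winning_from A W i S v}"

definition determined :: "('v, 'l) arena \<Rightarrow> (nat \<Rightarrow> 'v) set \<Rightarrow> bool" where
  "determined A W \<longleftrightarrow>
     winning_region A W P0 \<union> winning_region A W P1 = verts A \<and>
     winning_region A W P0 \<inter> winning_region A W P1 = {}"

definition pointwise_memoryless ::
  "('v, 'l) arena \<Rightarrow> (nat \<Rightarrow> 'v) set \<Rightarrow> player \<Rightarrow> bool" where
  "pointwise_memoryless A W i \<longleftrightarrow>
     (\<forall>v \<in> winning_region A W i. \<exists>S. strategy A i S \<and> memoryless A i S \<and> winning_from A W i S v)"

definition uniform_memoryless ::
  "('v, 'l) arena \<Rightarrow> (nat \<Rightarrow> 'v) set \<Rightarrow> player \<Rightarrow> bool" where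
  "uniform_memoryless A W i \<longleftrightarrow>
     (\<exists>S. strategy A i S \<and> memoryless A i S \<and> (\<forall>v \<in> winning_region A W i. winning_from A W i S v))"

definition pointwise_memoryless_determined ::
  "('v, 'l) arena \<Rightarrow> (nat \<Rightarrow> 'v) set \<Rightarrow> bool" where
  "pointwise_memoryless_determined A W \<longleftrightarrow>
     determined A W \<and> (\<forall>i. pointwise_memoryless A W i)"

definition uniform_memoryless_determined ::
  "('v, 'l) arena \<Rightarrow> (nat \<Rightarrow> 'v) set \<Rightarrow> bool" where
  "uniform_memoryless_determined A W \<longleftrightarrow>
     determined A W \<and> (\<forall>i. uniform_memoryless A W i)"

definition is_cycle :: "('v \<times> 'v) list \<Rightarrow> bool" where
  "is_cycle c \<longleftrightarrow>
     c \<noteq> [] \<and> successively (\<lambda>e f. snd e = fst f) c \<and> snd (last c) = fst (hd c)"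

text \<open>Stacks are lists of edges with the top at the end, so that a popped cycle is listed in the
  order in which it was traversed. The \<open>LEAST\<close> only fixes a choice: along a play, the stack before a
  push is a path without repeated vertices, so at most one \<open>k\<close> qualifies.\<close>

definition top_cycle :: "('v \<times> 'v) list \<Rightarrow> nat \<Rightarrow> bool" where
  "top_cycle st k \<longleftrightarrow> k \<le> length st \<and> is_cycle (drop (length st - k) st)"

definition pop_step ::
  "('v \<times> 'v) list \<Rightarrow> ('v \<times> 'v) list \<times> ('v \<times> 'v) list option" where
  "pop_step st =
     (if \<exists>k. top_cycle st k
      then let n = length st - (LEAST k. top_cycle st k) in (take n st, Some (drop n st))
      else (st, None))"

primrec stack :: "(nat \<Rightarrow> 'v) \<Rightarrow> nat \<Rightarrow> ('v \<times> 'v) list" where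
  "stack \<pi> 0 = []"
| "stack \<pi> (Suc j) = fst (pop_step (stack \<pi> j @ [(\<pi> j, \<pi> (Suc j))]))"

definition popped :: "(nat \<Rightarrow> 'v) \<Rightarrow> nat \<Rightarrow> ('v \<times> 'v) list option" where
  "popped \<pi> j = snd (pop_step (stack \<pi> j @ [(\<pi> j, \<pi> (Suc j))]))"

text \<open>\<open>cycles \<pi> n\<close> is the output of the \<open>n\<close>-th step (counting from 0) that outputs a cycle. By
  \<open>infinite_popped\<close> below, there are infinitely many such steps along a play of an arena.\<close>

definition cycles :: "(nat \<Rightarrow> 'v) \<Rightarrow> nat \<Rightarrow> ('v \<times> 'v) list" where
  "cycles \<pi> n = the (popped \<pi> (enumerate {j. popped \<pi> j \<noteq> None} n))"

definition first_cycle :: "(nat \<Rightarrow> 'v) \<Rightarrow> ('v \<times> 'v) list" where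
  "first_cycle \<pi> = cycles \<pi> 0"

definition O_FC :: "('v, 'l) arena \<Rightarrow> 'l list set \<Rightarrow> (nat \<Rightarrow> 'v) set" where
  "O_FC A Y = {\<pi> \<in> plays A. map (lab A) (first_cycle \<pi>) \<in> Y}"

definition O_EAC :: "('v, 'l) arena \<Rightarrow> 'l list set \<Rightarrow> (nat \<Rightarrow> 'v) set" where
  "O_EAC A Y =
     {\<pi> \<in> plays A. \<exists>j. \<forall>u \<in> range (cycles (suffix_at \<pi> j)). map (lab A) u \<in> Y}"

definition unambiguous :: "('v, 'l) arena \<Rightarrow> 'l list set \<Rightarrow> bool" where
  "unambiguous A Y \<longleftrightarrow> O_EAC A Y \<inter> O_EAC A (lists (labels A) - Y) = {}"

definition closed_cyclic_perm :: "'l set \<Rightarrow> 'l list set \<Rightarrow> bool" where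
  "closed_cyclic_perm U Y \<longleftrightarrow> (\<forall>a \<in> U. \<forall>b \<in> lists U. a # b \<in> Y \<longrightarrow> b @ [a] \<in> Y)"

lemma infinite_popped:
  assumes A: "is_arena A" and \<pi>: "\<pi> \<in> plays A"
  shows "infinite {j. popped \<pi> j \<noteq> None}"
proof
  assume "finite {j. popped \<pi> j \<noteq> None}"
  then obtain J where J: "\<And>j. j \<ge> J \<Longrightarrow> popped \<pi> j = None"
    by (metis (mono_tags, lifting) finite_nat_set_iff_bounded leD mem_Collect_eq)
  let ?e = "\<lambda>j. (\<pi> j, \<pi> (Suc j))"
  have no: "\<not> top_cycle (stack \<pi> j @ [?e j]) k" if "j \<ge> J" for j k
    using J[OF that] by (auto simp: popped_def pop_step_def Let_def split: if_splits)
  have st: "stack \<pi> (J + n) = stack \<pi> J @ map ?e [J..<J + n]" for n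
  proof (induction n)
    case (Suc n)
    have "\<not> (\<exists>k. top_cycle (stack \<pi> (J + n) @ [?e (J + n)]) k)" using no by simp
    then show ?case using Suc by (simp add: pop_step_def)
  qed simp
  have fin: "finite (verts A)" using A by (simp add: is_arena_def verts_def)
  have "\<pi> j \<in> verts A" for j
    using A \<pi> by (fastforce simp: is_arena_def plays_def)
  then have "finite (\<pi> ` {J..})" using fin by (meson finite_subset image_subsetI)
  then have "\<not> inj_on \<pi> {J..}" using finite_imageD infinite_Ici by blast
  then obtain x y where xy: "J \<le> x" "x < y" "\<pi> x = \<pi> y"
    by (auto simp: inj_on_def) (metis linorder_neqE_nat)
  then obtain m where m: "y = Suc m" "x \<le> m" by (cases y) auto
  obtain n where n: "m = J + n" using m xy le_Suc_ex le_trans by metis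
  have full: "stack \<pi> m @ [?e m] = stack \<pi> J @ map ?e [J..<y]"
    using st[of n] n m by simp
  let ?c = "map ?e [x..<y]"
  have "[J..<y] = [J..<x] @ [x..<y]"
    using xy by (metis le_Suc_ex less_imp_le upt_add_eq_append)
  then have eq: "stack \<pi> m @ [?e m] = (stack \<pi> J @ map ?e [J..<x]) @ ?c"
    using full by simp
  have "is_cycle ?c"
    using xy m by (auto simp: is_cycle_def successively_conv_nth hd_map last_map simp del: upt_Suc)
  then have "top_cycle (stack \<pi> m @ [?e m]) (length ?c)"
    unfolding top_cycle_def eq by simp
  then show False using no[of m "length ?c"] m xy by auto
qed

end

theory Submission
  imports Defs
begin

text \<open>The first-cycle game has a finite game tree, hence is determined. A player who can force the
  first cycle to be good can replay this on the current stack forever, so that every cycle of the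
  decomposition is good for him. By unambiguity, Player \<open>i\<close>, playing like this, therefore never
  reaches a vertex \<open>v\<close> won by the opponent: there the opponent would do the same with a fresh stack.

  Let \<open>x\<close> be a vertex of Player \<open>i\<close> with several successors. If \<open>x\<close> is won by \<open>i\<close> after deleting
  all edges at \<open>x\<close> but \<open>(x, y)\<close>, this deletion does not change the winning regions, since the
  opponent wins in the smaller arena without visiting \<open>x\<close>. If no such \<open>y\<close> exists, the opponent
  wins from \<open>x\<close>, because a play from \<open>x\<close> uses only one edge at \<open>x\<close> before its first cycle closes;
  then \<open>i\<close> wins without visiting \<open>x\<close>, and any deletion will do. Once every vertex of \<open>i\<close> has a
  single successor, the remaining edges are a memoryless strategy that is winning from the whole
  winning region.\<close>

section \<open>Stacks as simple paths\<close>

text \<open>Along a play the stack is a simple path. It is kept as its list of vertices, which shows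
  the current vertex even when the stack is empty.\<close>

definition edge_list :: "'v list \<Rightarrow> ('v \<times> 'v) list" where
  "edge_list s = zip s (tl s)"

text \<open>The cycle closed by moving from the end of a simple path \<open>s\<close> back to a
  vertex \<open>w\<close> on it; every use is guarded by \<open>w \<in> set s\<close>.\<close>

definition closed_cycle :: "'v list \<Rightarrow> 'v \<Rightarrow> ('v \<times> 'v) list" where
  "closed_cycle s w = edge_list (dropWhile (\<lambda>x. x \<noteq> w) s @ [w])"

text \<open>The path left after a push and a possible pop: popping the cycle at \<open>w\<close>
  keeps one copy of \<open>w\<close> as the new end.\<close>

definition extend_path :: "'v list \<Rightarrow> 'v \<Rightarrow> 'v list" where
  "extend_path s w = (if w \<in> set s then takeWhile (\<lambda>x. x \<noteq> w) s @ [w] else s @ [w])"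

primrec path_stack :: "(nat \<Rightarrow> 'v) \<Rightarrow> nat \<Rightarrow> 'v list" where
  "path_stack \<pi> 0 = [\<pi> 0]"
| "path_stack \<pi> (Suc j) = extend_path (path_stack \<pi> j) (\<pi> (Suc j))"

lemma length_edge_list [simp]: "length (edge_list s) = length s - 1"
  by (simp add: edge_list_def)

lemma nth_edge_list [simp]: "Suc i < length s \<Longrightarrow> edge_list s ! i = (s ! i, s ! Suc i)"
  by (simp add: edge_list_def nth_tl)

lemma drop_edge_list: "drop n (edge_list s) = edge_list (drop n s)"
  by (simp add: edge_list_def drop_zip tl_drop)

lemma take_edge_list: "take n (edge_list s) = edge_list (take (Suc n) s)"
  by (rule nth_equalityI) auto

lemma edge_list_snoc: "s \<noteq> [] \<Longrightarrow> edge_list (s @ [w]) = edge_list s @ [(last s, w)]"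
  by (induction s rule: induct_list012) (simp_all add: edge_list_def)

lemma is_cycle_edge_list: "is_cycle (edge_list s) \<longleftrightarrow> 2 \<le> length s \<and> hd s = last s"
proof (cases "2 \<le> length s")
  case True
  then have ne: "edge_list s \<noteq> []" "s \<noteq> []" by (auto simp flip: length_greater_0_conv)
  have "successively (\<lambda>e f. snd e = fst f) (edge_list s)"
    by (auto simp: successively_conv_nth)
  moreover have "snd (last (edge_list s)) = last s" "fst (hd (edge_list s)) = hd s"
    using True ne by (auto simp: last_conv_nth hd_conv_nth numeral_2_eq_2 Suc_diff_Suc)
  ultimately show ?thesis using True ne by (auto simp: is_cycle_def)
next
  case False
  then have "edge_list s = []" by (simp flip: length_0_conv)
  with False show ?thesis by (simp add: is_cycle_def)
qed

text \<open>The top \<open>k\<close> edges span the last \<open>k + 1\<close> vertices of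
  \<open>s @ [w]\<close>, so they form a cycle iff the first of these is \<open>w\<close>;
  \<open>k = 0\<close> drops out because cycles are non-empty.\<close>

lemma top_cycle_edge_list:
  assumes "s \<noteq> []"
  shows "top_cycle (edge_list (s @ [w])) k \<longleftrightarrow> 0 < k \<and> k \<le> length s \<and> s ! (length s - k) = w"
proof -
  have "hd (drop (length s - k) (s @ [w])) = s ! (length s - k)" if "0 < k" "k \<le> length s"
    using that assms by (subst hd_drop_conv_nth) (auto simp: nth_append)
  moreover have "last (drop (length s - k) (s @ [w])) = w" by simp
  ultimately show ?thesis
    by (auto simp: top_cycle_def drop_edge_list is_cycle_edge_list simp del: drop_append)
qed

text \<open>As \<open>s\<close> is distinct, \<open>w\<close> occurs in it at most once, so at most
  one \<open>k\<close> qualifies and \<open>LEAST\<close> picks it.\<close>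

lemma pop_step_edge_list:
  assumes "s \<noteq> []" "distinct s"
  shows "pop_step (edge_list (s @ [w])) =
    (edge_list (extend_path s w), if w \<in> set s then Some (closed_cycle s w) else None)"
proof (cases "w \<in> set s")
  case True
  then obtain a b where s: "s = a @ w # b" "w \<notin> set a" by (meson split_list_first)
  have w: "s ! i = w \<longleftrightarrow> i = length a" if "i < length s" for i
    using nth_eq_iff_index_eq[OF assms(2) that, of "length a"] s by simp
  \<comment> \<open>The cycle has one edge for each vertex of \<open>w # b\<close>; the
    \<open>length a\<close> edges below it remain on the stack.\<close>
  have top: "top_cycle (edge_list (s @ [w])) k \<longleftrightarrow> k = Suc (length b)" for k
    unfolding top_cycle_edge_list[OF assms(1)] using w[of "length s - k"] s(1) assms(1)
    by (auto simp: diff_less)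
  have least: "Least (top_cycle (edge_list (s @ [w]))) = Suc (length b)"
    by (rule Least_equality) (simp_all add: top)
  have "takeWhile (\<lambda>x. x \<noteq> w) s = a" "dropWhile (\<lambda>x. x \<noteq> w) s = w # b"
    using s by (auto simp: takeWhile_append dropWhile_append)
  then have c: "extend_path s w = a @ [w]" "closed_cycle s w = edge_list (w # b @ [w])"
    using True by (simp_all add: extend_path_def closed_cycle_def)
  have "pop_step (edge_list (s @ [w])) =
    (take (length a) (edge_list (s @ [w])), Some (drop (length a) (edge_list (s @ [w]))))"
    using arg_cong[OF s(1), of length] by (simp add: pop_step_def top least Let_def)
  then show ?thesis using True unfolding c take_edge_list drop_edge_list by (simp add: s(1))
next
  case False
  then have "\<not> top_cycle (edge_list (s @ [w])) k" for k
    unfolding top_cycle_edge_list[OF assms(1)] using nth_mem[of "length s - k" s] by auto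
  then show ?thesis using False by (simp add: pop_step_def extend_path_def)
qed

lemma extend_path_props:
  assumes "distinct s"
  shows "extend_path s w \<noteq> []" "distinct (extend_path s w)" "last (extend_path s w) = w"
  using assms by (auto simp: extend_path_def dest: set_takeWhileD)

lemma path_stack_props:
  "path_stack \<pi> j \<noteq> [] \<and> distinct (path_stack \<pi> j) \<and> last (path_stack \<pi> j) = \<pi> j"
  by (induction j) (auto simp: extend_path_props)

lemma stack_eq_path_stack: "stack \<pi> j = edge_list (path_stack \<pi> j)"
proof (induction j)
  case (Suc j)
  then show ?case
    using path_stack_props[of \<pi> j] edge_list_snoc[of "path_stack \<pi> j" "\<pi> (Suc j)"]
      pop_step_edge_list[of "path_stack \<pi> j" "\<pi> (Suc j)"] by simp
qed (simp add: edge_list_def)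

lemma popped_eq:
  "popped \<pi> j = (if \<pi> (Suc j) \<in> set (path_stack \<pi> j)
     then Some (closed_cycle (path_stack \<pi> j) (\<pi> (Suc j))) else None)"
  using path_stack_props[of \<pi> j] edge_list_snoc[of "path_stack \<pi> j" "\<pi> (Suc j)"]
    pop_step_edge_list[of "path_stack \<pi> j" "\<pi> (Suc j)"]
  by (simp add: popped_def stack_eq_path_stack)

lemma set_pop_step: "set (fst (pop_step st)) \<subseteq> set st"
  "snd (pop_step st) = Some c \<Longrightarrow> set c \<subseteq> set st"
  by (auto simp: pop_step_def Let_def split: if_splits dest: in_set_takeD in_set_dropD)

lemma set_stack:
  assumes "\<pi> \<in> plays A"
  shows "set (stack \<pi> j) \<subseteq> edges A"
proof (induction j)
  case (Suc j)
  moreover have "(\<pi> j, \<pi> (Suc j)) \<in> edges A" using assms by (simp add: plays_def)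
  ultimately show ?case
    using set_pop_step(1)[of "stack \<pi> j @ [(\<pi> j, \<pi> (Suc j))]"] by auto
qed simp

lemma set_popped:
  assumes "\<pi> \<in> plays A" "popped \<pi> j = Some c"
  shows "set c \<subseteq> edges A"
proof -
  have "(\<pi> j, \<pi> (Suc j)) \<in> edges A" using assms by (simp add: plays_def)
  then show ?thesis
    using set_pop_step(2) assms(2) set_stack[OF assms(1), of j] unfolding popped_def by fastforce
qed

lemma popped_enumerate:
  assumes "is_arena A" "\<pi> \<in> plays A"
  shows "popped \<pi> (enumerate {j. popped \<pi> j \<noteq> None} n) = Some (cycles \<pi> n)"
  using enumerate_in_set[OF infinite_popped[OF assms], of n] by (simp add: cycles_def)

section \<open>The finite first-cycle game\<close>

fun opp :: "player \<Rightarrow> player" where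
  "opp P0 = P1"
| "opp P1 = P0"

text \<open>Player 1 gets the plain complement of \<open>Y\<close>; on cycles of an arena it agrees
  with the complement inside \<open>lists (labels A)\<close>.\<close>

fun good :: "('v, 'l) arena \<Rightarrow> 'l list set \<Rightarrow> player \<Rightarrow> ('v \<times> 'v) list \<Rightarrow> bool" where
  "good A Y P0 c \<longleftrightarrow> map (lab A) c \<in> Y"
| "good A Y P1 c \<longleftrightarrow> map (lab A) c \<notin> Y"

text \<open>\<open>forces A Y i p\<close>: having seen the simple path \<open>p\<close>, Player \<open>i\<close> can force the first cycle to
  be good for him.\<close>

inductive forces :: "('v, 'l) arena \<Rightarrow> 'l list set \<Rightarrow> player \<Rightarrow> 'v list \<Rightarrow> bool"
  for A Y i where
  own: "\<lbrakk>last p \<in> owned A i; (last p, w) \<in> edges A;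
     w \<in> set p \<Longrightarrow> good A Y i (closed_cycle p w);
     w \<notin> set p \<Longrightarrow> forces A Y i (p @ [w])\<rbrakk> \<Longrightarrow> forces A Y i p"
| other: "\<lbrakk>last p \<in> owned A (opp i);
     \<And>w. (last p, w) \<in> edges A \<Longrightarrow> w \<in> set p \<Longrightarrow> good A Y i (closed_cycle p w);
     \<And>w. (last p, w) \<in> edges A \<Longrightarrow> w \<notin> set p \<Longrightarrow> forces A Y i (p @ [w])\<rbrakk>
     \<Longrightarrow> forces A Y i p"

abbreviation safe :: "('v, 'l) arena \<Rightarrow> 'l list set \<Rightarrow> player \<Rightarrow> 'v list \<Rightarrow> 'v \<Rightarrow> bool" where
  "safe A Y i p w \<equiv> (w \<in> set p \<longrightarrow> good A Y i (closed_cycle p w)) \<and>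
     (w \<notin> set p \<longrightarrow> forces A Y i (p @ [w]))"

lemma opp_opp [simp]: "opp (opp i) = i"
  by (cases i) auto

lemma good_opp: "good A Y (opp i) c \<longleftrightarrow> \<not> good A Y i c"
  by (cases i) auto

lemma owned_cases:
  assumes "v \<in> verts A"
  obtains "v \<in> owned A i" | "v \<in> owned A (opp i)"
  using assms by (cases i) (auto simp: verts_def)

lemma owned_disjoint: "is_arena A \<Longrightarrow> v \<in> owned A i \<Longrightarrow> v \<notin> owned A (opp i)"
  by (cases i) (auto simp: is_arena_def)

lemma owned_subset: "owned A i \<subseteq> verts A"
  by (cases i) (auto simp: verts_def)

lemma edge_in_verts: "is_arena A \<Longrightarrow> (v, w) \<in> edges A \<Longrightarrow> v \<in> verts A \<and> w \<in> verts A"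
  by (auto simp: is_arena_def)

lemma forces_step:
  assumes "is_arena A" "forces A Y i p"
  shows "(last p \<in> owned A i \<and> (\<exists>w. (last p, w) \<in> edges A \<and> safe A Y i p w)) \<or>
    (last p \<in> owned A (opp i) \<and> (\<forall>w. (last p, w) \<in> edges A \<longrightarrow> safe A Y i p w))"
  using assms(2) by cases auto

text \<open>The common last vertex has one owner. His own choice is safe for him, and the other
  player, for whom every move there is safe, accepts it.\<close>

lemma forces_common_step:
  assumes A: "is_arena A" and "forces A Y i p" "forces A Y (opp i) q" "last p = last q"
  shows "\<exists>w. (last p, w) \<in> edges A \<and> safe A Y i p w \<and> safe A Y (opp i) q w"
  using forces_step[OF A assms(2)] forces_step[OF A assms(3)] owned_disjoint[OF A, of "last p" i]
  unfolding opp_opp assms(4) by blast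

lemma finite_verts: "is_arena A \<Longrightarrow> finite (verts A)"
  by (simp add: is_arena_def verts_def)

text \<open>Backward induction over the finite tree of simple paths: if the owner of the last vertex
  has no safe move, then every move is safe for his opponent.\<close>

lemma forces_dichotomy:
  assumes A: "is_arena A"
  shows "p \<noteq> [] \<Longrightarrow> distinct p \<Longrightarrow> set p \<subseteq> verts A \<Longrightarrow> forces A Y i p \<or> forces A Y (opp i) p"
proof (induction "card (verts A) - length p" arbitrary: p rule: less_induct)
  case less
  have IH: "forces A Y i (p @ [w]) \<or> forces A Y (opp i) (p @ [w])"
    if w: "(last p, w) \<in> edges A" "w \<notin> set p" for w
  proof (rule less.hyps)
    \<comment> \<open>Subtraction is truncated, so the measure drops only because the longer path
      still fits into \<open>verts A\<close>.\<close>
    have "set (p @ [w]) \<subseteq> verts A" using less.prems edge_in_verts[OF A w(1)] by auto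
    then have "card (set (p @ [w])) \<le> card (verts A)"
      by (rule card_mono[OF finite_verts[OF A]])
    then show "card (verts A) - length (p @ [w]) < card (verts A) - length p"
      using less.prems w(2) by (simp add: distinct_card)
  qed (use less.prems w edge_in_verts[OF A w(1)] in auto)
  have safe: "safe A Y i p w \<or> safe A Y (opp i) p w" if "(last p, w) \<in> edges A" for w
    using IH[OF that] good_opp by blast
  have "last p \<in> verts A" using less.prems last_in_set by blast
  then show ?case
  proof (cases rule: owned_cases[of _ _ i])
    case 1
    show ?thesis
    proof (cases "\<exists>w. (last p, w) \<in> edges A \<and> safe A Y i p w")
      case True
      then show ?thesis using forces.own[of p A i] 1 by blast
    next
      case False
      then show ?thesis using forces.other[of p A "opp i"] 1 safe by auto
    qed
  next
    case 2
    show ?thesis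
    proof (cases "\<exists>w. (last p, w) \<in> edges A \<and> safe A Y (opp i) p w")
      case True
      then show ?thesis using forces.own[of p A "opp i"] 2 by blast
    next
      case False
      then show ?thesis using forces.other[of p A i] 2 safe by auto
    qed
  qed
qed

text \<open>The stacks that can arise while Player \<open>i\<close> makes safe moves. All non-empty
  prefixes are forcing too, so the win is still forced after a cycle has been cut off.\<close>

inductive secure :: "('v, 'l) arena \<Rightarrow> 'l list set \<Rightarrow> player \<Rightarrow> 'v list \<Rightarrow> bool"
  for A Y i where
  single: "forces A Y i [v] \<Longrightarrow> secure A Y i [v]"
| snoc: "\<lbrakk>secure A Y i p; (last p, w) \<in> edges A; w \<notin> set p; forces A Y i (p @ [w])\<rbrakk>
     \<Longrightarrow> secure A Y i (p @ [w])"

lemma secure_props: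
  assumes "secure A Y i p"
  shows "p \<noteq> [] \<and> distinct p \<and> forces A Y i p \<and> set (edge_list p) \<subseteq> edges A"
  using assms by induction (auto simp: edge_list_snoc, auto simp: edge_list_def)

lemma secure_prefix:
  assumes "secure A Y i (p @ q)" "p \<noteq> []"
  shows "secure A Y i p"
  using assms(1)
proof (induction q rule: rev_induct)
  case (snoc w q)
  from snoc.prems have "secure A Y i (p @ q)"
  proof cases
    case (single v)
    then show ?thesis using assms(2) by (cases p) auto
  qed auto
  then show ?case by (rule snoc.IH)
qed simp

text \<open>Closing a cycle cuts the path back to a non-empty prefix, which is again secure;
  otherwise the path grows by a forcing step.\<close>

lemma secure_extend_path:
  assumes "secure A Y i p" "(last p, w) \<in> edges A" "safe A Y i p w"
  shows "secure A Y i (extend_path p w)"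
proof (cases "w \<in> set p")
  case True
  then obtain a b where s: "p = a @ w # b" "w \<notin> set a" by (meson split_list_first)
  then have "extend_path p w = a @ [w]"
    using True by (auto simp: extend_path_def takeWhile_append)
  then show ?thesis using secure_prefix[of A Y i "a @ [w]" b] assms(1) s by simp
next
  case False
  then show ?thesis using assms secure.snoc[of A Y i p w] by (simp add: extend_path_def)
qed

section \<open>Unambiguous arenas\<close>

text \<open>The index \<open>k\<close> witnesses the suffix. Popped cycles consist of edges of the
  arena, so their labels form words over \<open>labels A\<close>, as the complement
  requires.\<close>

lemma O_EAC_good:
  assumes A: "is_arena A" and \<pi>: "\<pi> \<in> plays A"
    and good: "\<And>j c. popped (suffix_at \<pi> k) j = Some c \<Longrightarrow> good A Y i c"
  shows "\<pi> \<in> O_EAC A (if i = P0 then Y else lists (labels A) - Y)"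
proof -
  let ?\<rho> = "suffix_at \<pi> k"
  have \<rho>: "?\<rho> \<in> plays A" using \<pi> by (simp add: plays_def suffix_at_def)
  have "map (lab A) (cycles ?\<rho> n) \<in> (if i = P0 then Y else lists (labels A) - Y)" for n
  proof -
    note pop = popped_enumerate[OF A \<rho>, of n]
    have "set (cycles ?\<rho> n) \<subseteq> edges A" by (rule set_popped[OF \<rho> pop])
    then have "map (lab A) (cycles ?\<rho> n) \<in> lists (labels A)"
      using A by (fastforce simp: is_arena_def)
    then show ?thesis using good[OF pop] by (cases i) auto
  qed
  then show ?thesis unfolding O_EAC_def using \<pi> by blast
qed

text \<open>While the play runs along the simple path \<open>p\<close>, no vertex repeats and
  nothing is popped.\<close>

lemma path_stack_prefix:
  assumes "distinct p" "\<And>m. m < length p \<Longrightarrow> \<pi> m = p ! m" "m < length p"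
  shows "path_stack \<pi> m = take (Suc m) p"
  using assms(3)
proof (induction m)
  case 0
  then show ?case using assms(2)[of 0] by (cases p) auto
next
  case (Suc m)
  have "p ! Suc m \<notin> set (take (Suc m) p)"
    using assms(1) Suc.prems by (auto simp: in_set_conv_nth nth_eq_iff_index_eq)
  then show ?case using Suc assms(2)[of "Suc m"]
    by (simp add: extend_path_def take_Suc_conv_app_nth)
qed

text \<open>Both players can follow their own stacks, started at different times, forever: all cycles
  from some point on are then good for both of them.\<close>

lemma secure_opp_False:
  assumes A: "is_arena A" and un: "unambiguous A Y"
    and p: "secure A Y i p" and q: "forces A Y (opp i) [last p]"
  shows False
proof -
  \<comment> \<open>The pair holds the stack of \<open>i\<close>, which starts as \<open>p\<close>,
    and that of the opponent, which starts afresh at the end of \<open>p\<close>. Both always end in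
    the current vertex.\<close>
  let ?P = "\<lambda>(n::nat) s. secure A Y i (fst s) \<and> secure A Y (opp i) (snd s) \<and> last (fst s) = last (snd s)
     \<and> (n = 0 \<longrightarrow> s = (p, [last p]))"
  let ?Q = "\<lambda>(n::nat) s t. \<exists>w. (last (fst s), w) \<in> edges A \<and> safe A Y i (fst s) w \<and>
     safe A Y (opp i) (snd s) w \<and> t = (extend_path (fst s) w, extend_path (snd s) w)"
  have "\<exists>s. \<forall>n. ?P n (s n) \<and> ?Q n (s n) (s (Suc n))"
  proof (rule dependent_nat_choice)
    show "\<exists>s. ?P 0 s" using p q secure.single by fastforce
  next
    fix s n
    assume s: "?P n s"
    then have sec: "secure A Y i (fst s)" "secure A Y (opp i) (snd s)"
      and l: "last (fst s) = last (snd s)" by auto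
    obtain w where w: "(last (fst s), w) \<in> edges A" "safe A Y i (fst s) w" "safe A Y (opp i) (snd s) w"
      using forces_common_step[OF A _ _ l] secure_props[OF sec(1)] secure_props[OF sec(2)] by blast
    moreover have "last (extend_path (fst s) w) = last (extend_path (snd s) w)"
      using secure_props[OF sec(1)] secure_props[OF sec(2)] by (simp add: extend_path_props)
    moreover have "secure A Y i (extend_path (fst s) w)" "secure A Y (opp i) (extend_path (snd s) w)"
      using secure_extend_path sec w l by metis+
    ultimately show "\<exists>t. ?P (Suc n) t \<and> ?Q n s t" by auto
  qed
  then obtain s where s: "\<And>n. ?P n (s n)" and Q: "\<And>n. ?Q n (s n) (s (Suc n))" by blast
  obtain k where k: "length p = Suc k" using secure_props[OF p] by (cases p) auto
  \<comment> \<open>The play first runs through \<open>p\<close>, reaching its end at time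
    \<open>k\<close>, and then follows the common end of the two stacks.\<close>
  define \<pi> where "\<pi> m = (if m < length p then p ! m else last (fst (s (m - k))))" for m
  have s0: "s 0 = (p, [last p])" using s[of 0] by simp
  have \<pi>s: "\<pi> (k + n) = last (fst (s n))" for n
    using k s0 secure_props[OF p] by (cases n) (auto simp: \<pi>_def last_conv_nth)
  have w: "(last (fst (s n)), \<pi> (k + Suc n)) \<in> edges A" "safe A Y i (fst (s n)) (\<pi> (k + Suc n))"
    "safe A Y (opp i) (snd (s n)) (\<pi> (k + Suc n))"
    "s (Suc n) = (extend_path (fst (s n)) (\<pi> (k + Suc n)), extend_path (snd (s n)) (\<pi> (k + Suc n)))" for n
  proof -
    obtain w where w: "(last (fst (s n)), w) \<in> edges A" "safe A Y i (fst (s n)) w"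
      "safe A Y (opp i) (snd (s n)) w"
      "s (Suc n) = (extend_path (fst (s n)) w, extend_path (snd (s n)) w)" using Q[of n] by blast
    have "secure A Y i (fst (s n))" using s[of n] by simp
    then have "last (fst (s (Suc n))) = w" using w(4) by (simp add: secure_props extend_path_props)
    then have "\<pi> (k + Suc n) = w" by (simp only: \<pi>s)
    with w show "(last (fst (s n)), \<pi> (k + Suc n)) \<in> edges A" "safe A Y i (fst (s n)) (\<pi> (k + Suc n))"
    "safe A Y (opp i) (snd (s n)) (\<pi> (k + Suc n))"
    "s (Suc n) = (extend_path (fst (s n)) (\<pi> (k + Suc n)), extend_path (snd (s n)) (\<pi> (k + Suc n)))"
      by blast+
  qed
  have pref: "path_stack \<pi> m = take (Suc m) p" if "m < length p" for m
    by (rule path_stack_prefix) (use that secure_props[OF p] in \<open>auto simp: \<pi>_def\<close>)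
  \<comment> \<open>The two components are the true stacks of the play, begun at time 0 and at time
    \<open>k\<close>.\<close>
  have st1: "path_stack \<pi> (k + n) = fst (s n)" for n
  proof (induction n)
    case 0
    show ?case using pref[of k] k s0 by simp
  next
    case (Suc n)
    then show ?case using w(4)[of n] by simp
  qed
  have st2: "path_stack (suffix_at \<pi> k) n = snd (s n)" for n
  proof (induction n)
    case 0
    show ?case using \<pi>s[of 0] s0 by (simp add: suffix_at_def)
  next
    case (Suc n)
    then show ?case using w(4)[of n] by (simp add: suffix_at_def)
  qed
  have "(\<pi> m, \<pi> (Suc m)) \<in> edges A" for m
  proof (cases "m < k")
    case True
    have "edge_list p ! m \<in> set (edge_list p)" using True k by (intro nth_mem) simp
    then show ?thesis using True k secure_props[OF p] by (auto simp: \<pi>_def)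
  next
    case False
    then obtain n where "m = k + n" using le_Suc_ex not_less by blast
    then show ?thesis using w(1)[of n] \<pi>s[of n] by simp
  qed
  then have \<pi>: "\<pi> \<in> plays A" by (simp add: plays_def)
  \<comment> \<open>Before time \<open>k\<close> the simple path \<open>p\<close> closes no cycle;
    afterwards every move is safe for \<open>i\<close>.\<close>
  have "good A Y i c" if c: "popped (suffix_at \<pi> 0) m = Some c" for m c
  proof (cases "m < k")
    case True
    have "\<pi> (Suc m) \<in> set (path_stack \<pi> m)"
      using c by (auto simp: suffix_at_def popped_eq split: if_splits)
    then have "p ! Suc m \<in> set (take (Suc m) p)" using pref[of m] True k by (auto simp: \<pi>_def)
    then show ?thesis using secure_props[OF p] True k
      by (auto simp: in_set_conv_nth nth_eq_iff_index_eq)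
  next
    case False
    then obtain n where "m = k + n" using le_Suc_ex not_less by blast
    then show ?thesis using c w(2)[of n] st1[of n]
      by (auto simp: suffix_at_def popped_eq split: if_splits)
  qed
  from O_EAC_good[OF A \<pi> this]
  have 1: "\<pi> \<in> O_EAC A (if i = P0 then Y else lists (labels A) - Y)" .
  have "good A Y (opp i) c" if "popped (suffix_at \<pi> k) n = Some c" for n c
    using that w(3)[of n] st2[of n] by (auto simp: popped_eq suffix_at_def split: if_splits)
  from O_EAC_good[OF A \<pi> this]
  have 2: "\<pi> \<in> O_EAC A (if opp i = P0 then Y else lists (labels A) - Y)" .
  show False using 1 2 un unfolding unambiguous_def by (cases i) auto
qed

section \<open>Removing edges of one player\<close>

text \<open>The invariant \<open>Q\<close> keeps all paths of the forcing tree from ending in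
  \<open>x\<close>, the only vertex where the moves of \<open>A\<close> and \<open>B\<close> differ.
  The tree is therefore a forcing tree in \<open>B\<close> as well.\<close>

lemma forces_transfer:
  assumes "forces A Y i p" "Q p"
    and Q: "\<And>p w. \<lbrakk>Q p; (last p, w) \<in> edges A; w \<notin> set p; forces A Y i (p @ [w])\<rbrakk> \<Longrightarrow> Q (p @ [w])"
    and avoid: "\<And>p. Q p \<Longrightarrow> last p \<noteq> x"
    and agree: "\<And>u w. u \<noteq> x \<Longrightarrow> (u, w) \<in> edges A \<longleftrightarrow> (u, w) \<in> edges B"
    and same: "\<And>i. owned B i = owned A i" "lab B = lab A"
  shows "forces B Y i p"
  using assms(1,2)
proof induction
  have good: "good B Y i c = good A Y i c" for c by (cases i) (simp_all add: same)
  {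
    case (own p w)
    have "(last p, w) \<in> edges B" using own avoid agree by blast
    then show ?case using own Q[of p w] same good by (intro forces.own[of p B i w]) auto
  next
    case (other p)
    have e: "(last p, w) \<in> edges B \<longleftrightarrow> (last p, w) \<in> edges A" for w using other.prems avoid agree by blast
    show ?case using other Q[of p] same good e by (intro forces.other[of p B i]) auto
  }
qed

definition restrict_succ :: "('v, 'l) arena \<Rightarrow> 'v \<Rightarrow> 'v \<Rightarrow> ('v, 'l) arena" where
  "restrict_succ A x y = A\<lparr>edges := {(u, w) \<in> edges A. u = x \<longrightarrow> w = y}\<rparr>"

definition subarena :: "('v, 'l) arena \<Rightarrow> ('v, 'l) arena \<Rightarrow> bool" where
  "subarena B A \<longleftrightarrow> is_arena B \<and> verts0 B = verts0 A \<and> verts1 B = verts1 A \<and>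
     edges B \<subseteq> edges A \<and> labels B = labels A \<and> lab B = lab A"

lemma subarena_owned: "subarena B A \<Longrightarrow> owned B i = owned A i"
  by (cases i) (auto simp: subarena_def)

text \<open>Plays of \<open>B\<close> are plays of \<open>A\<close> with the same cycles and labels,
  so both objectives only shrink.\<close>

lemma subarena_unambiguous:
  assumes "subarena B A" "unambiguous A Y"
  shows "unambiguous B Y"
proof -
  have "O_EAC B Z \<subseteq> O_EAC A Z" for Z
    using assms(1) by (auto simp: O_EAC_def plays_def subarena_def)
  then show ?thesis using assms unfolding unambiguous_def subarena_def by (metis Int_mono subset_empty)
qed

lemma subarena_restrict_succ:
  assumes "is_arena A" "(x, y) \<in> edges A"
  shows "subarena (restrict_succ A x y) A"
proof -
  have "\<exists>w. (v, w) \<in> edges A \<and> (v = x \<longrightarrow> w = y)" if "v \<in> verts A" for v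
    using assms that unfolding is_arena_def by (cases "v = x") auto
  moreover have "verts (restrict_succ A x y) = verts A"
    by (simp add: restrict_succ_def verts_def)
  ultimately have "is_arena (restrict_succ A x y)"
    using assms(1) unfolding is_arena_def by (auto simp: restrict_succ_def)
  then show ?thesis by (auto simp: subarena_def restrict_succ_def)
qed

lemma owned_restrict_succ [simp]: "owned (restrict_succ A x y) i = owned A i"
  by (cases i) (simp_all add: restrict_succ_def)

lemma edges_restrict_succ [simp]:
  "(u, w) \<in> edges (restrict_succ A x y) \<longleftrightarrow> (u, w) \<in> edges A \<and> (u = x \<longrightarrow> w = y)"
  by (simp add: restrict_succ_def)

lemma lab_restrict_succ [simp]: "lab (restrict_succ A x y) = lab A"
  by (simp add: restrict_succ_def)

text \<open>A single round of edge deletion. The cases differ in whether \<open>x\<close> itself is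
  won by \<open>i\<close> after some choice of \<open>y\<close>.\<close>

lemma exists_restrict_succ:
  assumes A: "is_arena A" and un: "unambiguous A Y" and x: "x \<in> owned A i"
  shows "\<exists>y. (x, y) \<in> edges A \<and> (\<forall>v. forces A Y i [v] \<longrightarrow> v \<in> verts A \<longrightarrow> forces (restrict_succ A x y) Y i [v])"
proof (cases "\<exists>y. (x, y) \<in> edges A \<and> forces (restrict_succ A x y) Y i [x]")
  case True
  then obtain y where y: "(x, y) \<in> edges A" and fx: "forces (restrict_succ A x y) Y i [x]" by blast
  let ?B = "restrict_succ A x y"
  note B = subarena_restrict_succ[OF A y]
  have arB: "is_arena ?B" using B by (simp add: subarena_def)
  note unB = subarena_unambiguous[OF B un]
  have "forces ?B Y i [v]" if v: "forces A Y i [v]" "v \<in> verts A" for v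
  proof (rule ccontr)
    assume "\<not> forces ?B Y i [v]"
    moreover have "v \<in> verts ?B" using v(2) B by (simp add: verts_def subarena_def)
    ultimately have f: "forces ?B Y (opp i) [v]" using forces_dichotomy[OF arB, of "[v]"] by auto
    \<comment> \<open>In \<open>?B\<close> the vertex \<open>x\<close> is won by \<open>i\<close>,
      so the opponent's forcing tree from \<open>v\<close> never reaches \<open>x\<close> and
      survives in \<open>A\<close>.\<close>
    have "forces A Y (opp i) [v]"
    proof (rule forces_transfer[where Q = "secure ?B Y (opp i)" and x = x, OF f])
      show "secure ?B Y (opp i) [v]" by (rule secure.single[OF f])
      show "last p \<noteq> x" if "secure ?B Y (opp i) p" for p
        using secure_opp_False[OF arB unB that] fx by auto
    qed (auto intro: secure.snoc)
    then show False using secure_opp_False[OF A un secure.single[OF v(1)]] by simp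
  qed
  with y show ?thesis by blast
next
  case False
  \<comment> \<open>For each successor \<open>y\<close>, the opponent wins from \<open>x\<close>
    when \<open>y\<close> is the only move there, so the step to \<open>y\<close> is safe for him.
    It remains to lift this safety to \<open>A\<close>.\<close>
  have fx: "forces A Y (opp i) [x]"
  proof (rule forces.other)
    show "last [x] \<in> owned A (opp (opp i))" using x by simp
  next
    fix y assume e: "(last [x], y) \<in> edges A"
    let ?B = "restrict_succ A x y"
    have y: "(x, y) \<in> edges A" using e by simp
    note B = subarena_restrict_succ[OF A y]
    have arB: "is_arena ?B" using B by (simp add: subarena_def)
    have xB: "x \<in> owned ?B i" using x subarena_owned[OF B] by simp
    have "x \<in> verts ?B" by (rule subsetD[OF owned_subset xB])
    then have "forces ?B Y (opp i) [x]"
      using forces_dichotomy[OF arB, of "[x]" Y i] False y by auto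
    moreover have "x \<notin> owned ?B (opp i)" using owned_disjoint[OF arB xB] .
    ultimately have safe: "safe ?B Y (opp i) [x] y"
      using forces_step[OF arB, of Y "opp i" "[x]"] y by auto
    have gd: "good ?B Y (opp i) c = good A Y (opp i) c" for c
      by (cases i) simp_all
    show "good A Y (opp i) (closed_cycle [x] y)" if "y \<in> set [x]"
      using that safe gd by blast
    \<comment> \<open>Once \<open>x\<close> lies on the path and is not its end, returning to
      \<open>x\<close> closes the first cycle; hence no edge leaving \<open>x\<close> is used
      again.\<close>
    show "forces A Y (opp i) ([x] @ [y])" if ny: "y \<notin> set [x]"
    proof (rule forces_transfer[where Q = "\<lambda>p. x \<in> set p \<and> last p \<noteq> x" and x = x])
      show "forces ?B Y (opp i) ([x] @ [y])" using safe ny by blast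
    qed (use ny in auto)
  qed
  obtain y where y: "(x, y) \<in> edges A"
    using A subsetD[OF owned_subset x] unfolding is_arena_def by blast
  let ?B = "restrict_succ A x y"
  note B = subarena_restrict_succ[OF A y]
  \<comment> \<open>As \<open>x\<close> is won by the opponent, the forcing tree of \<open>i\<close>
    avoids \<open>x\<close>, whatever \<open>y\<close> was chosen.\<close>
  have "forces ?B Y i [v]" if v: "forces A Y i [v]" for v
  proof (rule forces_transfer[where Q = "secure A Y i" and x = x, OF v])
    show "secure A Y i [v]" by (rule secure.single[OF v])
    show "last p \<noteq> x" if "secure A Y i p" for p
      using secure_opp_False[OF A un that] fx by auto
  qed (auto intro: secure.snoc)
  with y show ?thesis by blast
qed

text \<open>Induction on the number of edges, fixing the successor of one branching vertex of
  \<open>i\<close> at a time. Edges of the opponent all stay, so that his moves in \<open>A\<close>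
  remain available in \<open>B\<close>.\<close>

lemma exists_deterministic_subarena:
  assumes "is_arena A" "unambiguous A Y"
  shows "\<exists>B. subarena B A \<and> (\<forall>u w. u \<in> owned A (opp i) \<longrightarrow> (u, w) \<in> edges A \<longrightarrow> (u, w) \<in> edges B) \<and>
    (\<forall>u w w'. u \<in> owned A i \<longrightarrow> (u, w) \<in> edges B \<longrightarrow> (u, w') \<in> edges B \<longrightarrow> w = w') \<and>
    (\<forall>v \<in> verts A. forces A Y i [v] \<longrightarrow> forces B Y i [v])"
  using assms
proof (induction "card (edges A)" arbitrary: A rule: less_induct)
  case less
  note A = less.prems(1) and un = less.prems(2)
  show ?case
  proof (cases "\<exists>x w w'. x \<in> owned A i \<and> (x, w) \<in> edges A \<and> (x, w') \<in> edges A \<and> w \<noteq> w'")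
    case False
    then show ?thesis using A by (intro exI[of _ A]) (auto simp: subarena_def)
  next
    case True
    then obtain x w w' where x: "x \<in> owned A i" and w: "(x, w) \<in> edges A" "(x, w') \<in> edges A" "w \<noteq> w'"
      by blast
    obtain y where y: "(x, y) \<in> edges A"
      and f: "\<forall>v. forces A Y i [v] \<longrightarrow> v \<in> verts A \<longrightarrow> forces (restrict_succ A x y) Y i [v]"
      using exists_restrict_succ[OF A un x] by blast
    let ?B = "restrict_succ A x y"
    note B = subarena_restrict_succ[OF A y]
    have arB: "is_arena ?B" using B by (simp add: subarena_def)
    have fin: "finite (edges A)"
      using A finite_subset[OF _ finite_cartesian_product[OF finite_verts[OF A] finite_verts[OF A]]]
      by (simp add: is_arena_def)
    \<comment> \<open>At least one of the two distinct edges at \<open>x\<close> is gone, so the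
      inclusion is strict.\<close>
    have "\<not> ((x, w) \<in> edges ?B \<and> (x, w') \<in> edges ?B)" using w(3) by auto
    moreover have "edges ?B \<subseteq> edges A" by auto
    ultimately have "edges ?B \<subset> edges A" using w(1,2) by blast
    then have "card (edges ?B) < card (edges A)" by (rule psubset_card_mono[OF fin])
    from less.hyps[OF this arB subarena_unambiguous[OF B un]]
    obtain C where C: "subarena C ?B"
      "\<forall>u w. u \<in> owned ?B (opp i) \<longrightarrow> (u, w) \<in> edges ?B \<longrightarrow> (u, w) \<in> edges C"
      "\<forall>u w w'. u \<in> owned ?B i \<longrightarrow> (u, w) \<in> edges C \<longrightarrow> (u, w') \<in> edges C \<longrightarrow> w = w'"
      "\<forall>v \<in> verts ?B. forces ?B Y i [v] \<longrightarrow> forces C Y i [v]" by blast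
    have "verts ?B = verts A" by (simp add: restrict_succ_def verts_def)
    moreover have "subarena C A" using B C(1) by (auto simp: subarena_def)
    moreover have "(u, w) \<in> edges ?B" if "u \<in> owned A (opp i)" "(u, w) \<in> edges A" for u w
      using that owned_disjoint[OF A x] by (auto simp: restrict_succ_def)
    ultimately show ?thesis
      using C(2-4) f unfolding subarena_owned[OF B] by (intro exI[of _ C]) blast
  qed
qed

section \<open>Determinacy\<close>

text \<open>At vertices of \<open>i\<close> the safe move is the only move, so every play stays in
  the forcing tree until its first pop.\<close>

lemma first_cycle_good:
  assumes A: "is_arena A" and \<pi>: "\<pi> \<in> plays A" and f: "forces A Y i [\<pi> 0]"
    and det: "\<And>u w w'. u \<in> owned A i \<Longrightarrow> (u, w) \<in> edges A \<Longrightarrow> (u, w') \<in> edges A \<Longrightarrow> w = w'"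
  shows "good A Y i (first_cycle \<pi>)"
proof -
  let ?S = "{j. popped \<pi> j \<noteq> None}"
  define m where "m = enumerate ?S 0"
  have m: "popped \<pi> m = Some (first_cycle \<pi>)"
    using popped_enumerate[OF A \<pi>, of 0] by (simp add: m_def first_cycle_def)
  have before: "popped \<pi> j = None" if "j < m" for j
    using that not_less_Least unfolding m_def enumerate_0 by blast
  have safe: "safe A Y i (path_stack \<pi> j) (\<pi> (Suc j))" if "forces A Y i (path_stack \<pi> j)" for j
  proof -
    have "(\<pi> j, \<pi> (Suc j)) \<in> edges A" using \<pi> by (simp add: plays_def)
    then show ?thesis using forces_step[OF A that] path_stack_props[of \<pi> j] det by metis
  qed
  have "forces A Y i (path_stack \<pi> j)" if "j \<le> m" for j
    using that
  proof (induction j)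
    case 0
    show ?case using f by simp
  next
    case (Suc j)
    then have "\<pi> (Suc j) \<notin> set (path_stack \<pi> j)" using before[of j] by (auto simp: popped_eq)
    then show ?case using safe[of j] Suc by (simp add: extend_path_def)
  qed
  from safe[OF this[of m]] show ?thesis using m by (auto simp: popped_eq split: if_splits)
qed

lemma won_by_O_FC: "\<pi> \<in> plays A \<Longrightarrow> won_by (O_FC A Y) i \<pi> \<longleftrightarrow> good A Y i (first_cycle \<pi>)"
  by (cases i) (auto simp: O_FC_def)

text \<open>The strategy follows the one edge left at each vertex of \<open>i\<close>; plays of
  \<open>A\<close> consistent with it are then plays of \<open>B\<close>.\<close>

lemma uniform_memoryless_forces:
  assumes A: "is_arena A" and un: "unambiguous A Y"
  shows "\<exists>S. strategy A i S \<and> memoryless A i S \<and>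
    (\<forall>v \<in> verts A. forces A Y i [v] \<longrightarrow> winning_from A (O_FC A Y) i S v)"
proof -
  obtain B where B: "subarena B A"
    and other: "\<And>u w. u \<in> owned A (opp i) \<Longrightarrow> (u, w) \<in> edges A \<Longrightarrow> (u, w) \<in> edges B"
    and det: "\<And>u w w'. u \<in> owned A i \<Longrightarrow> (u, w) \<in> edges B \<Longrightarrow> (u, w') \<in> edges B \<Longrightarrow> w = w'"
    and f: "\<And>v. v \<in> verts A \<Longrightarrow> forces A Y i [v] \<Longrightarrow> forces B Y i [v]"
    using exists_deterministic_subarena[OF A un, of i] by blast
  have arB: "is_arena B" and sub: "edges B \<subseteq> edges A" using B by (auto simp: subarena_def)
  \<comment> \<open>Only the last vertex matters; for histories ending outside the arena the value
    is arbitrary.\<close>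
  define S where "S h = (SOME w. (last h, w) \<in> edges B)" for h
  have S: "(v, S (u @ [v])) \<in> edges B" if "v \<in> owned A i" for u v
  proof -
    have "v \<in> verts B" using that owned_subset[of B i] subarena_owned[OF B] by auto
    then have "\<exists>w. (v, w) \<in> edges B" using arB by (simp add: is_arena_def)
    then show ?thesis by (auto simp: S_def intro: someI)
  qed
  have "good A Y i (first_cycle \<pi>)"
    if \<pi>: "\<pi> \<in> plays A" and c: "consistent A i S \<pi>" and v: "\<pi> 0 \<in> verts A" "forces A Y i [\<pi> 0]" for \<pi>
  proof -
    have "(\<pi> j, \<pi> (Suc j)) \<in> edges B" for j
    proof -
      have e: "(\<pi> j, \<pi> (Suc j)) \<in> edges A" using \<pi> by (simp add: plays_def)
      then have "\<pi> j \<in> verts A" using edge_in_verts[OF A] by blast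
      then show ?thesis
      proof (cases rule: owned_cases[of _ _ i])
        case 1
        then show ?thesis using c S[OF 1, of "map \<pi> [0..<j]"] by (simp add: consistent_def)
      next
        case 2
        then show ?thesis using other e by blast
      qed
    qed
    then have "\<pi> \<in> plays B" by (simp add: plays_def)
    from first_cycle_good[OF arB this f[OF v]]
    have "good B Y i (first_cycle \<pi>)" using det subarena_owned[OF B] by metis
    then show ?thesis using B by (cases i) (auto simp: subarena_def)
  qed
  then have "\<forall>v \<in> verts A. forces A Y i [v] \<longrightarrow> winning_from A (O_FC A Y) i S v"
    by (auto simp: winning_from_def won_by_O_FC)
  moreover have "strategy A i S" using S sub by (auto simp: strategy_def)
  moreover have "memoryless A i S" by (simp add: memoryless_def S_def)
  ultimately show ?thesis by blast
qed

text \<open>Playing \<open>S\<close> against \<open>T\<close> gives one play consistent with both,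
  which both players would win.\<close>

lemma not_both_winning:
  assumes A: "is_arena A" and v: "v \<in> verts A"
    and S: "strategy A i S" "winning_from A W i S v"
    and T: "strategy A (opp i) T" "winning_from A W (opp i) T v"
  shows False
proof -
  define nxt where "nxt h = (if last h \<in> owned A i then S h else T h)" for h
  define H where "H n = ((\<lambda>h. h @ [nxt h]) ^^ n) [v]" for n
  define \<pi> where "\<pi> n = last (H n)" for n
  have HS: "H (Suc n) = H n @ [nxt (H n)]" for n by (simp add: H_def)
  have H: "H n = map \<pi> [0..<Suc n]" for n
  proof (induction n)
    case 0
    show ?case by (simp add: \<pi>_def H_def)
  next
    case (Suc n)
    have "H (Suc n) = map \<pi> [0..<Suc n] @ [\<pi> (Suc n)]"
      unfolding HS \<pi>_def[of "Suc n"] Suc by simp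
    then show ?case by simp
  qed
  have \<pi>S: "\<pi> (Suc n) = (if \<pi> n \<in> owned A i then S (map \<pi> [0..<Suc n]) else T (map \<pi> [0..<Suc n]))" for n
    unfolding \<pi>_def[of "Suc n"] HS nxt_def \<pi>_def[of n, symmetric] by (simp add: H del: upt_Suc)
  \<comment> \<open>Strategies are constrained only on histories over \<open>verts A\<close>, so
    membership of all earlier vertices is carried along.\<close>
  have "\<pi> n \<in> verts A \<and> (\<forall>m<n. \<pi> m \<in> verts A \<and> (\<pi> m, \<pi> (Suc m)) \<in> edges A)" for n
  proof (induction n)
    case 0
    show ?case using v by (simp add: \<pi>_def H_def)
  next
    case (Suc n)
    have h: "map \<pi> [0..<Suc n] = map \<pi> [0..<n] @ [\<pi> n]" by simp
    have u: "map \<pi> [0..<n] \<in> lists (verts A)" using Suc by auto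
    from Suc have "\<pi> n \<in> verts A" by simp
    then have "(\<pi> n, \<pi> (Suc n)) \<in> edges A"
    proof (cases rule: owned_cases[of _ _ i])
      case 1
      then show ?thesis using \<pi>S[of n] S(1) u unfolding h strategy_def by auto
    next
      case 2
      then have "\<pi> n \<notin> owned A i" using owned_disjoint[OF A] by blast
      then show ?thesis using \<pi>S[of n] T(1) u 2 unfolding h strategy_def by auto
    qed
    then show ?case using Suc edge_in_verts[OF A] by (auto simp: less_Suc_eq)
  qed
  then have pl: "\<pi> \<in> plays A" unfolding plays_def by blast
  have "consistent A i S \<pi>" using \<pi>S by (simp add: consistent_def del: upt_Suc)
  moreover have "consistent A (opp i) T \<pi>"
    using \<pi>S owned_disjoint[OF A] by (auto simp: consistent_def simp del: upt_Suc)
  moreover have "\<pi> 0 = v" by (simp add: \<pi>_def H_def)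
  ultimately have "won_by W i \<pi>" "won_by W (opp i) \<pi>"
    using pl S(2) T(2) by (auto simp: winning_from_def)
  then show False by (cases i) auto
qed

text \<open>If \<open>i\<close> cannot force a good first cycle, then the opponent can, and so has a
  winning strategy; that excludes any winning strategy of \<open>i\<close>.\<close>

lemma winning_region_O_FC:
  assumes A: "is_arena A" and un: "unambiguous A Y"
  shows "winning_region A (O_FC A Y) i = {v \<in> verts A. forces A Y i [v]}"
proof -
  have sub: "{v \<in> verts A. forces A Y i [v]} \<subseteq> winning_region A (O_FC A Y) i" for i
    using uniform_memoryless_forces[OF A un, of i] by (auto simp: winning_region_def)
  have "forces A Y i [v]" if "v \<in> winning_region A (O_FC A Y) i" for v
  proof (rule ccontr)
    assume "\<not> forces A Y i [v]"
    moreover have v: "v \<in> verts A" using that by (simp add: winning_region_def)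
    ultimately have "v \<in> winning_region A (O_FC A Y) (opp i)"
      using forces_dichotomy[OF A, of "[v]" Y i] sub[of "opp i"] by auto
    then show False using that not_both_winning[OF A v] unfolding winning_region_def by blast
  qed
  moreover have "winning_region A (O_FC A Y) i \<subseteq> verts A" by (auto simp: winning_region_def)
  ultimately show ?thesis using sub[of i] by blast
qed

lemma determined_O_FC:
  assumes A: "is_arena A" and un: "unambiguous A Y"
  shows "determined A (O_FC A Y)"
proof -
  have "\<not> (forces A Y P0 [v] \<and> forces A Y P1 [v])" for v
    using secure_opp_False[OF A un secure.single, of P0 v] by auto
  moreover have "forces A Y P0 [v] \<or> forces A Y P1 [v]" if "v \<in> verts A" for v
    using forces_dichotomy[OF A, of "[v]" Y P0] that by auto
  ultimately show ?thesis
    unfolding determined_def winning_region_O_FC[OF A un] by auto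
qed

theorem theorem4:
  fixes A :: "('v, 'l) arena" and Y :: "'l list set"
  assumes "is_arena A"
    and "Y \<subseteq> lists (labels A)"
    and "unambiguous A Y"
  shows "pointwise_memoryless_determined A (O_FC A Y) \<and>
    (closed_cyclic_perm (labels A) Y \<longrightarrow> uniform_memoryless_determined A (O_FC A Y))"
proof -
  have uni: "uniform_memoryless A (O_FC A Y) i" for i
    using uniform_memoryless_forces[OF assms(1,3), of i]
    by (auto simp: uniform_memoryless_def winning_region_O_FC[OF assms(1,3)])
  \<comment> \<open>One memoryless strategy for the whole region serves at each of its
    vertices.\<close>
  then have "pointwise_memoryless A (O_FC A Y) i" for i
    by (meson pointwise_memoryless_def uniform_memoryless_def)
  with uni determined_O_FC[OF assms(1,3)] show ?thesis
    by (simp add: pointwise_memoryless_determined_def uniform_memoryless_determined_def)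
qed

end
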